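(* Let $\Gamma$ be a connected regular graph of valency $k$ with exactly four distinct eigenvalues $k>\theta_1>\theta_2>\theta_3$. If $\theta_2\neq 0$ or $\theta_3\neq -\theta_1$, then there is at most one integer $\ell>1$ such that $\Gamma$ is strongly $\ell$-walk-regular.
   Context: Graphs are finite, simple and undirected. For an integer $\ell>1$, a graph $\Gamma$ is strongly $\ell$-walk-regular with parameters $(\lambda_\ell,\mu_\ell,\nu_\ell)$ if the number of walks of length $\ell$ between two vertices is $\lambda_\ell$ for every two adjacent vertices, $\mu_\ell$ for every two distinct non-adjacent vertices, and $\nu_\ell$ for every two identical vertices (i.e. from each vertex to itself). It is strongly $\ell$-walk-regular if this holds for some $\lambda_\ell,\mu_\ell,\nu_\ell$. Eigenvalues of a graph are the eigenvalues of its adjacency matrix. *)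

theory Defs
  imports
    "Graph_Theory.Pair_Digraph"
    "Graph_Theory.Digraph_Component"
    "Graph_Theory.Arc_Walk"
    "Jordan_Normal_Form.Char_Poly"
begin

text \<open>
  A finite simple undirected graph is a \<^locale>\<open>pair_graph\<close>: finitely many vertices,
  a symmetric loop-free arc relation, and no multiple arcs because arcs are pairs of vertices.
\<close>

definition regular_of_valency :: "'a pair_pre_digraph \<Rightarrow> nat \<Rightarrow> bool" where
  "regular_of_valency G k \<longleftrightarrow> (\<forall>u\<in>pverts G. out_degree (with_proj G) u = k)"

text \<open>
  Walks are represented by their arc lists; given the start vertex, an arc list and the
  corresponding vertex sequence determine each other, so this counts the usual walks.
\<close>

definition num_walks :: "'a pair_pre_digraph \<Rightarrow> nat \<Rightarrow> 'a \<Rightarrow> 'a \<Rightarrow> nat" where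
  "num_walks G l u v = card {p. pre_digraph.awalk (with_proj G) u p v \<and> length p = l}"

definition strongly_walk_regular_params ::
    "'a pair_pre_digraph \<Rightarrow> nat \<Rightarrow> nat \<Rightarrow> nat \<Rightarrow> nat \<Rightarrow> bool" where
  "strongly_walk_regular_params G l lam mu nu \<longleftrightarrow> l > 1 \<and>
     (\<forall>u\<in>pverts G. \<forall>v\<in>pverts G.
        ((u, v) \<in> parcs G \<longrightarrow> num_walks G l u v = lam) \<and>
        (u \<noteq> v \<and> (u, v) \<notin> parcs G \<longrightarrow> num_walks G l u v = mu) \<and>
        (u = v \<longrightarrow> num_walks G l u v = nu))"

definition strongly_walk_regular :: "'a pair_pre_digraph \<Rightarrow> nat \<Rightarrow> bool" where
  "strongly_walk_regular G l \<longleftrightarrow> (\<exists>lam mu nu. strongly_walk_regular_params G l lam mu nu)"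

definition adjacency_mat :: "'a pair_pre_digraph \<Rightarrow> 'a list \<Rightarrow> real mat" where
  "adjacency_mat G vs =
     mat (length vs) (length vs) (\<lambda>(i, j). if (vs ! i, vs ! j) \<in> parcs G then 1 else 0)"

text \<open>
  The adjacency matrix depends on an enumeration of the vertices, its eigenvalues do not
  (see \<open>graph_eigenvalues_enum\<close> below).
\<close>

definition graph_eigenvalues :: "'a pair_pre_digraph \<Rightarrow> real set" where
  "graph_eigenvalues G =
     {x. \<exists>vs. distinct vs \<and> set vs = pverts G \<and> eigenvalue (adjacency_mat G vs) x}"

lemma eigenvalue_adjacency_mat_iff:
  assumes d: "distinct vs" and s: "set vs = V"
  shows "eigenvalue (adjacency_mat G vs) x \<longleftrightarrow>
    (\<exists>f. (\<exists>v\<in>V. f v \<noteq> 0) \<and>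
         (\<forall>u\<in>V. (\<Sum>v\<in>V. (if (u, v) \<in> parcs G then 1 else 0) * f v) = x * f u))"
proof -
  let ?n = "length vs"
  let ?A = "adjacency_mat G vs"
  have bij: "bij_betw ((!) vs) {0..<?n} V"
    using bij_betw_nth[OF d, of "{0..<?n}" V] s by (simp add: atLeast0LessThan)
  have mv: "(?A *\<^sub>v w) $ i = (\<Sum>v\<in>V. (if (vs ! i, v) \<in> parcs G then 1 else 0) * f v)"
    if "i < ?n" "w \<in> carrier_vec ?n" "\<And>j. j < ?n \<Longrightarrow> f (vs ! j) = w $ j" for i w f
    using that unfolding sum.reindex_bij_betw[OF bij, symmetric]
    by (auto simp: adjacency_mat_def scalar_prod_def intro!: sum.cong)
  show ?thesis
  proof
    assume "eigenvalue ?A x"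
    then obtain w where w: "w \<in> carrier_vec ?n" "w \<noteq> 0\<^sub>v ?n" "?A *\<^sub>v w = x \<cdot>\<^sub>v w"
      by (auto simp: eigenvalue_def eigenvector_def adjacency_mat_def)
    define f where "f v = w $ (inv_into {0..<?n} ((!) vs) v)" for v
    have f: "f (vs ! j) = w $ j" if "j < ?n" for j
      using that bij by (simp add: f_def bij_betw_def)
    obtain j where "j < ?n" "w $ j \<noteq> 0"
      using w(1,2) by (auto simp: vec_eq_iff)
    then have 1: "\<exists>v\<in>V. f v \<noteq> 0" using f s by (auto intro!: bexI[of _ "vs ! j"])
    have "(\<Sum>v\<in>V. (if (u, v) \<in> parcs G then 1 else 0) * f v) = x * f u" if u: "u \<in> V" for u
    proof -
      obtain i where i: "i < ?n" "u = vs ! i" using u s by (auto simp: in_set_conv_nth)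
      have "(?A *\<^sub>v w) $ i = x * w $ i" using w i by simp
      then show ?thesis using mv[OF i(1) w(1) f] f i by simp
    qed
    with 1 show "\<exists>f. (\<exists>v\<in>V. f v \<noteq> 0) \<and>
         (\<forall>u\<in>V. (\<Sum>v\<in>V. (if (u, v) \<in> parcs G then 1 else 0) * f v) = x * f u)" by blast
  next
    assume "\<exists>f. (\<exists>v\<in>V. f v \<noteq> 0) \<and>
         (\<forall>u\<in>V. (\<Sum>v\<in>V. (if (u, v) \<in> parcs G then 1 else 0) * f v) = x * f u)"
    then obtain f where f: "\<exists>v\<in>V. f v \<noteq> 0"
      "\<And>u. u \<in> V \<Longrightarrow> (\<Sum>v\<in>V. (if (u, v) \<in> parcs G then 1 else 0) * f v) = x * f u" by blast
    define w where "w = vec ?n (\<lambda>j. f (vs ! j))"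
    have w: "w \<in> carrier_vec ?n" by (simp add: w_def)
    have "w \<noteq> 0\<^sub>v ?n"
    proof
      assume "w = 0\<^sub>v ?n"
      then have "f (vs ! j) = 0" if "j < ?n" for j
        using that by (auto simp: w_def vec_eq_iff)
      then show False using f(1) s by (auto simp: in_set_conv_nth)
    qed
    moreover have "?A *\<^sub>v w = x \<cdot>\<^sub>v w"
    proof (rule eq_vecI)
      fix i assume "i < dim_vec (x \<cdot>\<^sub>v w)"
      then have i: "i < ?n" by (simp add: w_def)
      have "(?A *\<^sub>v w) $ i = x * f (vs ! i)"
        using mv[OF i w, of f] f(2)[of "vs ! i"] i nth_mem[OF i] s by (simp add: w_def)
      then show "(?A *\<^sub>v w) $ i = (x \<cdot>\<^sub>v w) $ i" using i by (simp add: w_def)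
    qed (simp add: adjacency_mat_def w_def)
    ultimately show "eigenvalue ?A x" using w
      by (auto simp: eigenvalue_def eigenvector_def adjacency_mat_def)
  qed
qed

lemma graph_eigenvalues_enum:
  assumes "distinct vs" "set vs = pverts G"
  shows "graph_eigenvalues G = {x. eigenvalue (adjacency_mat G vs) x}"
  using assms eigenvalue_adjacency_mat_iff[of _ "pverts G" G]
  unfolding graph_eigenvalues_def by blast

end

theory Submission
  imports Defs
begin

text \<open>
  Restricting \<open>A\<^sup>l = \<lambda> A + \<mu> (J - I - A) + \<nu> I\<close> to the vectors with coordinate sum \<open>0\<close> shows that
  every eigenvalue other than the valency is a root of some trinomial \<open>x\<^sup>l - a x - b\<close>. By Rolle,
  three distinct real roots force \<open>l\<close> to be odd, and in the non-symmetric case \<open>b \<noteq> 0\<close>, so that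
  the absolute values of the roots are distinct and positive. Given a second such trinomial
  \<open>x\<^sup>m - c x - d\<close>, eliminating the constant terms and dividing by \<open>x\<close> leaves a combination of
  \<open>1\<close>, \<open>x\<^sup>l\<^sup>-\<^sup>1\<close> and \<open>x\<^sup>m\<^sup>-\<^sup>1\<close>. As its exponents are even, it vanishes at the three absolute values,
  whereas it has at most two positive roots.
\<close>

section \<open>Real roots of trinomials\<close>

text \<open>Rolle on each of the two intervals. The bound \<open>x < r\<close> is recorded so that
  both zeros of the derivative are positive when \<open>x\<close> is.\<close>

lemma Rolle_three_zeros:
  fixes f f' :: "real \<Rightarrow> real"
  assumes "x < y" "y < z" "f x = 0" "f y = 0" "f z = 0"
    and der: "\<And>t. (f has_real_derivative f' t) (at t)"
  obtains r s where "x < r" "r < s" "f' r = 0" "f' s = 0"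
proof -
  have cont: "continuous_on S f" for S
    using der by (meson DERIV_continuous_on has_field_derivative_at_within)
  have root: "\<exists>t. p < t \<and> t < q \<and> f' t = 0" if "p < q" "f p = 0" "f q = 0" for p q
  proof -
    have "\<exists>t>p. t < q \<and> (*) (f' t) = (\<lambda>v. 0)"
      by (rule Rolle_deriv[of p q f]) (use that cont der in \<open>auto simp: has_field_derivative_def\<close>)
    then show ?thesis by (metis mult.right_neutral)
  qed
  obtain r s where rs: "x < r" "r < y" "f' r = 0" "y < s" "f' s = 0"
    using root[of x y] root[of y z] assms(1-5) by blast
  show ?thesis by (rule that[of r s]) (use rs in auto)
qed

text \<open>For even \<open>l\<close> the derivative \<open>l * t ^ (l - 1) - a\<close> involves an
  odd power, which is injective, so it cannot have the two zeros that Rolle provides.\<close>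

lemma odd_if_three_roots:
  fixes a b :: real
  assumes "x < y" "y < z" "x ^ l = a * x + b" "y ^ l = a * y + b" "z ^ l = a * z + b" "l > 1"
  shows "odd l"
proof
  assume "even l"
  define f where "f t = t ^ l - a * t - b" for t
  have der: "(f has_real_derivative (real l * t ^ (l - 1) - a)) (at t)" for t
    unfolding f_def by (auto intro!: derivative_eq_intros)
  obtain r s where rs: "r < s" "real l * r ^ (l - 1) - a = 0" "real l * s ^ (l - 1) - a = 0"
    by (rule Rolle_three_zeros[of x y z f, OF _ _ _ _ _ der]) (use assms in \<open>auto simp: f_def\<close>)
  have "odd (l - 1)" using \<open>even l\<close> \<open>l > 1\<close> by simp
  moreover have "real l * r ^ (l - 1) = real l * s ^ (l - 1)" using rs by linarith
  then have "r ^ (l - 1) = s ^ (l - 1)" using \<open>l > 1\<close> by simp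
  ultimately show False using rs(1) odd_real_root_unique by (metis less_irrefl)
qed

text \<open>Without a constant term, every nonzero root satisfies \<open>t ^ (l - 1) = a\<close>
  with \<open>l - 1\<close> even. So all nonzero roots share one absolute value, and three distinct
  roots must be 0 and a pair of opposite numbers.\<close>

lemma symmetric_roots_if_constant_zero:
  fixes a b :: real
  assumes "x < y" "y < z" "x ^ l = a * x + b" "y ^ l = a * y + b" "z ^ l = a * z + b"
    and "odd l" "l > 1" "b = 0"
  shows "y = 0 \<and> x = - z"
proof -
  have pow: "t ^ (l - 1) = a" if "t ^ l = a * t + b" "t \<noteq> 0" for t
    using that assms(7,8) power_minus_mult[of l t] by (metis add.right_neutral
        mult_right_cancel not_gr0 not_less_zero)
  have abs: "\<bar>s\<bar> = \<bar>t\<bar>"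
    if "s ^ l = a * s + b" "s \<noteq> 0" "t ^ l = a * t + b" "t \<noteq> 0" for s t
  proof -
    have "even (l - 1)" "l - 1 > 0" using assms by auto
    moreover have "s ^ (l - 1) = t ^ (l - 1)" using pow that by simp
    ultimately show ?thesis
      by (metis power_even_abs abs_ge_zero power_eq_imp_eq_base)
  qed
  have xy: "x = 0 \<or> y = 0 \<or> x = - y" using abs[of x y] assms by argo
  have yz: "y = 0 \<or> z = 0 \<or> y = - z" using abs[of y z] assms by argo
  have xz: "x = 0 \<or> z = 0 \<or> x = - z" using abs[of x z] assms by argo
  show ?thesis
    using xy yz xz \<open>x < y\<close> \<open>y < z\<close> by linarith
qed

text \<open>The derivative is \<open>t ^ (p - 1)\<close> times a binomial in
  \<open>t ^ (q - p)\<close>. The latter power is strictly increasing for positive \<open>t\<close>,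
  so at most one positive zero is possible, while Rolle gives two.\<close>

lemma no_three_positive_roots:
  fixes \<alpha> \<beta> \<gamma> :: real
  assumes "0 < x" "x < y" "y < z" "0 < p" "p < q" "\<alpha> \<noteq> 0"
    and "\<alpha> * x ^ p + \<beta> * x ^ q = \<gamma>" "\<alpha> * y ^ p + \<beta> * y ^ q = \<gamma>" "\<alpha> * z ^ p + \<beta> * z ^ q = \<gamma>"
  shows False
proof -
  define f where "f t = \<alpha> * t ^ p + \<beta> * t ^ q - \<gamma>" for t
  define f' where "f' t = \<alpha> * (real p * t ^ (p - 1)) + \<beta> * (real q * t ^ (q - 1))" for t
  have der: "(f has_real_derivative f' t) (at t)" for t
    unfolding f_def f'_def by (auto intro!: derivative_eq_intros)
  obtain r s where rs: "x < r" "r < s" "f' r = 0" "f' s = 0"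
    by (rule Rolle_three_zeros[of x y z f, OF _ _ _ _ _ der]) (use assms in \<open>auto simp: f_def\<close>)
  have split: "f' t = t ^ (p - 1) * (\<alpha> * real p + \<beta> * real q * t ^ (q - p))" for t
  proof -
    have "q - 1 = (p - 1) + (q - p)" using assms by simp
    then have "t ^ (q - 1) = t ^ (p - 1) * t ^ (q - p)" by (simp add: power_add)
    then show ?thesis by (simp add: f'_def algebra_simps)
  qed
  have eq: "\<alpha> * real p + \<beta> * real q * r ^ (q - p) = 0" "\<alpha> * real p + \<beta> * real q * s ^ (q - p) = 0"
    using rs split[of r] split[of s] \<open>0 < x\<close> by auto
  have "\<beta> \<noteq> 0" using eq(1) assms by auto
  moreover have "\<beta> * real q * r ^ (q - p) = \<beta> * real q * s ^ (q - p)" using eq by linarith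
  ultimately have "r ^ (q - p) = s ^ (q - p)" using assms by simp
  moreover have "r ^ (q - p) < s ^ (q - p)"
    using rs assms by (intro power_strict_mono) auto
  ultimately show False by simp
qed

text \<open>The version without an order on the roots, needed because taking absolute values may
  reorder them.\<close>

lemma no_three_distinct_positive_roots:
  fixes \<alpha> \<beta> \<gamma> :: real
  assumes "finite S" "card S = 3" "0 < p" "p < q" "\<alpha> \<noteq> 0"
    and "\<And>t. t \<in> S \<Longrightarrow> 0 < t \<and> \<alpha> * t ^ p + \<beta> * t ^ q = \<gamma>"
  shows False
proof -
  obtain x y z where S: "S = {x, y, z}" "x \<noteq> y" "y \<noteq> z" "x \<noteq> z"
    using assms(2) by (auto simp: card_3_iff)
  have *: False if "u \<in> S" "v \<in> S" "w \<in> S" "u < v" "v < w" for u v w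
    using no_three_positive_roots[of u v w p q \<alpha> \<beta> \<gamma>] that assms(3-6) by blast
  show False
    using S *[of x y z] *[of x z y] *[of y x z] *[of y z x] *[of z x y] *[of z y x]
    by (metis insertI1 insertI2 linorder_neqE_linordered_idom)
qed

lemma no_common_roots_less:
  fixes a b c d :: real
  assumes order: "x < y" "y < z" "1 < l" "l < m" and asym: "y \<noteq> 0 \<or> x \<noteq> - z"
    and p: "\<And>t. t \<in> {x, y, z} \<Longrightarrow> t ^ l = a * t + b"
    and q: "\<And>t. t \<in> {x, y, z} \<Longrightarrow> t ^ m = c * t + d"
  shows False
proof -
  have "1 < m" using order by simp
  have roots: "x ^ l = a * x + b" "y ^ l = a * y + b" "z ^ l = a * z + b"
    "x ^ m = c * x + d" "y ^ m = c * y + d" "z ^ m = c * z + d"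
    using p q by blast+
  have odd: "odd l" "odd m"
    using odd_if_three_roots[OF order(1,2) roots(1-3) \<open>1 < l\<close>]
      odd_if_three_roots[OF order(1,2) roots(4-6) \<open>1 < m\<close>] by auto
  have nz: "b \<noteq> 0" "d \<noteq> 0"
    using symmetric_roots_if_constant_zero[OF order(1,2) roots(1-3) odd(1) \<open>1 < l\<close>]
      symmetric_roots_if_constant_zero[OF order(1,2) roots(4-6) odd(2) \<open>1 < m\<close>] asym by auto
  have t0: "t \<noteq> 0" if "t \<in> {x, y, z}" for t
    using p[OF that] nz order(3) by (auto simp: power_0_left)
  \<comment> \<open>For opposite roots the odd powers and the linear terms both cancel in the sum of
    the two equations, leaving \<open>2 * b = 0\<close>.\<close>
  have neg: "- t \<notin> {x, y, z}" if "t \<in> {x, y, z}" for t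
  proof
    assume "- t \<in> {x, y, z}"
    then have "t ^ l + (- t) ^ l = 2 * b" using p[OF that] p[OF \<open>- t \<in> {x, y, z}\<close>] by linarith
    then show False using odd nz by simp
  qed
  have inj: "inj_on abs {x, y, z}"
    using neg by (intro inj_onI) (metis abs_eq_iff)
  have "card (abs ` {x, y, z}) = 3"
    using card_image[OF inj] order(1,2) by auto
  \<comment> \<open>The weights \<open>d\<close> and \<open>- b\<close> cancel the constants:
    \<open>d * (a * s + b) - b * (c * s + d) = (a * d - b * c) * s\<close>, and then the nonzero
    \<open>s\<close> can be divided out.\<close>
  moreover have "0 < t \<and> d * t ^ (l - 1) + - b * t ^ (m - 1) = a * d - b * c"
    if t: "t \<in> abs ` {x, y, z}" for t
  proof -
    obtain s where s: "t = \<bar>s\<bar>" "s \<in> {x, y, z}" using t by blast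
    have pm: "s ^ (l - 1) * s = a * s + b" "s ^ (m - 1) * s = c * s + d"
      using p[OF s(2)] q[OF s(2)] power_minus_mult[of l s] power_minus_mult[of m s] order by auto
    have "(d * s ^ (l - 1) + - b * s ^ (m - 1)) * s
        = d * (s ^ (l - 1) * s) - b * (s ^ (m - 1) * s)"
      by (simp add: algebra_simps)
    also have "\<dots> = (a * d - b * c) * s"
      unfolding pm by (simp add: algebra_simps)
    finally have "d * s ^ (l - 1) + - b * s ^ (m - 1) = a * d - b * c"
      using t0[OF s(2)] by simp
    moreover have "t ^ (l - 1) = s ^ (l - 1)" "t ^ (m - 1) = s ^ (m - 1)"
      using odd s by (simp_all add: power_even_abs)
    ultimately show ?thesis using t0[OF s(2)] s by simp
  qed
  ultimately show False
    using no_three_distinct_positive_roots[of "abs ` {x, y, z}" "l - 1" "m - 1" d "- b"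
        "a * d - b * c"] diff_less_mono[of l m 1] order nz by auto
qed

section \<open>Counting walks\<close>

lemma (in pair_graph) finite_walks_of_length: "finite {p. awalk u p v \<and> length p = l}"
  by (rule finite_subset[OF _ finite_lists_length_eq[OF finite_arcs, of l]])
    (auto simp: awalk_def)

lemma (in pair_graph) num_walks_0:
  "u \<in> pverts G \<Longrightarrow> num_walks G 0 u v = (if u = v then 1 else 0)"
proof -
  assume "u \<in> pverts G"
  then have "{p. awalk u p v \<and> length p = 0} = (if u = v then {[]} else {})"
    by (auto simp: awalk_Nil_iff)
  then show ?thesis by (simp add: num_walks_def)
qed

text \<open>Split off the first arc; walks with different second vertices have different arc lists,
  so the union is disjoint. The indicator form is the entrywise recursion for powers of the
  adjacency matrix.\<close>

lemma (in pair_graph) num_walks_Suc: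
  assumes "u \<in> pverts G"
  shows "num_walks G (Suc l) u v
    = (\<Sum>w\<in>pverts G. (if (u, w) \<in> parcs G then 1 else 0) * num_walks G l w v)"
proof -
  let ?N = "{w\<in>pverts G. (u, w) \<in> parcs G}"
  let ?W = "\<lambda>w. (#) (u, w) ` {p. awalk w p v \<and> length p = l}"
  have "p \<in> {p. awalk u p v \<and> length p = Suc l} \<longleftrightarrow> p \<in> (\<Union>w\<in>?N. ?W w)" for p
    using in_arcsD2 by (cases p) (auto simp: awalk_Cons_iff)
  then have "{p. awalk u p v \<and> length p = Suc l} = (\<Union>w\<in>?N. ?W w)"
    by blast
  then have "num_walks G (Suc l) u v = card (\<Union>w\<in>?N. ?W w)"
    by (simp add: num_walks_def)
  also have "\<dots> = (\<Sum>w\<in>?N. card (?W w))"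
    by (rule card_UN_disjoint) (use finite_verts finite_walks_of_length in auto)
  also have "\<dots> = (\<Sum>w\<in>?N. num_walks G l w v)"
    by (simp add: card_image num_walks_def)
  also have "\<dots> = (\<Sum>w\<in>pverts G. (if (u, w) \<in> parcs G then 1 else 0) * num_walks G l w v)"
    unfolding sum.inter_filter[OF finite_verts] by (intro sum.cong) auto
  finally show ?thesis .
qed

section \<open>Walk counts acting on eigenfunctions\<close>

definition (in pair_graph) eigenfunction :: "real \<Rightarrow> ('a \<Rightarrow> real) \<Rightarrow> bool" where
  "eigenfunction x f \<longleftrightarrow>
    (\<forall>u\<in>pverts G. (\<Sum>v\<in>pverts G. (if (u, v) \<in> parcs G then 1 else 0) * f v) = x * f u)"

lemma (in pair_graph) sum_num_walks_eigenfunction: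
  assumes "eigenfunction x f" "u \<in> pverts G"
  shows "(\<Sum>v\<in>pverts G. real (num_walks G l u v) * f v) = x ^ l * f u"
  using assms(2)
proof (induction l arbitrary: u)
  case 0
  then show ?case
    by (simp add: num_walks_0 if_distrib[of "\<lambda>c. c * _"] if_distrib[of real] cong: if_cong)
next
  case (Suc l)
  let ?a = "\<lambda>w. if (u, w) \<in> parcs G then 1 else 0 :: real"
  have "(\<Sum>v\<in>pverts G. real (num_walks G (Suc l) u v) * f v)
      = (\<Sum>v\<in>pverts G. \<Sum>w\<in>pverts G. ?a w * (real (num_walks G l w v) * f v))"
    using Suc.prems
    by (auto simp: num_walks_Suc sum_distrib_right sum_distrib_left intro!: sum.cong)
  also have "\<dots> = (\<Sum>w\<in>pverts G. ?a w * (\<Sum>v\<in>pverts G. real (num_walks G l w v) * f v))"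
    by (subst sum.swap) (simp add: sum_distrib_left)
  also have "\<dots> = (\<Sum>w\<in>pverts G. x ^ l * (?a w * f w))"
    by (intro sum.cong refl) (simp add: Suc.IH)
  also have "\<dots> = x ^ Suc l * f u"
    using assms(1) Suc.prems by (simp add: eigenfunction_def flip: sum_distrib_left)
  finally show ?case .
qed

text \<open>By symmetry the columns of the adjacency matrix also sum to \<open>k\<close>. Summing
  the eigenvalue equation over all vertices thus multiplies the total of \<open>f\<close> by both
  \<open>x\<close> and \<open>k\<close>.\<close>

lemma (in pair_graph) sum_eigenfunction_eq_0:
  assumes "eigenfunction x f" "regular_of_valency G k" "x \<noteq> real k"
  shows "(\<Sum>v\<in>pverts G. f v) = 0"
proof -
  let ?a = "\<lambda>u w. if (u, w) \<in> parcs G then 1 else 0 :: real"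
  have sym: "?a u v = ?a v u" for u v
    using arcs_symmetric by auto
  have row: "(\<Sum>u\<in>pverts G. ?a v u) = real k" if "v \<in> pverts G" for v
  proof -
    have "out_arcs (with_proj G) v = Pair v ` {u\<in>pverts G. (v, u) \<in> parcs G}"
      using in_arcsD2 by (auto simp: out_arcs_def)
    moreover have "card (out_arcs (with_proj G) v) = k"
      using assms(2) that by (auto simp: regular_of_valency_def out_degree_def)
    ultimately have "k = card {u\<in>pverts G. (v, u) \<in> parcs G}"
      by (simp add: card_image inj_on_def)
    then show ?thesis by (simp add: sum.If_cases Int_def)
  qed
  have "x * (\<Sum>u\<in>pverts G. f u) = (\<Sum>u\<in>pverts G. \<Sum>v\<in>pverts G. ?a u v * f v)"
    using assms(1) by (simp add: eigenfunction_def sum_distrib_left)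
  also have "\<dots> = (\<Sum>v\<in>pverts G. (\<Sum>u\<in>pverts G. ?a v u) * f v)"
    by (subst sum.swap) (simp only: sym sum_distrib_right)
  also have "\<dots> = real k * (\<Sum>v\<in>pverts G. f v)"
    by (simp add: row sum_distrib_left)
  finally show ?thesis using assms(3) by simp
qed

lemma (in pair_graph) eigenfunction_if_graph_eigenvalue:
  assumes "x \<in> graph_eigenvalues G"
  obtains f u where "eigenfunction x f" "u \<in> pverts G" "f u \<noteq> 0"
proof -
  obtain vs where "distinct vs" "set vs = pverts G" "eigenvalue (adjacency_mat G vs) x"
    using assms by (auto simp: graph_eigenvalues_def)
  then obtain f where "\<exists>u\<in>pverts G. f u \<noteq> 0" "eigenfunction x f"
    unfolding eigenfunction_def by (subst (asm) eigenvalue_adjacency_mat_iff) auto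
  then show ?thesis using that by blast
qed

lemma (in pair_graph) strongly_walk_regular_trinomial:
  assumes "regular_of_valency G k" "strongly_walk_regular G l"
  obtains a b :: real
  where "\<And>x. \<lbrakk>x \<in> graph_eigenvalues G; x \<noteq> real k\<rbrakk> \<Longrightarrow> x ^ l = a * x + b"
proof -
  obtain lam mu nu where swr: "strongly_walk_regular_params G l lam mu nu"
    using assms(2) by (auto simp: strongly_walk_regular_def)
  have "x ^ l = (real lam - real mu) * x + (real nu - real mu)"
    if x: "x \<in> graph_eigenvalues G" "x \<noteq> real k" for x
  proof -
    obtain f u where f: "eigenfunction x f" "u \<in> pverts G" "f u \<noteq> 0"
      using eigenfunction_if_graph_eigenvalue[OF x(1)] .
    let ?a = "\<lambda>v. if (u, v) \<in> parcs G then 1 else 0 :: real"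
    let ?i = "\<lambda>v. if u = v then 1 else 0 :: real"
    \<comment> \<open>The row of \<open>u\<close> in the combination of adjacency, all-ones and
      identity matrices. On the diagonal the adjacency term vanishes, as there are no loops, and
      \<open>nu\<close> remains.\<close>
    have walks: "real (num_walks G l u v)
        = (real lam - real mu) * ?a v + real mu + (real nu - real mu) * ?i v"
      if "v \<in> pverts G" for v
      using swr that f(2) no_loops'[of u u] by (auto simp: strongly_walk_regular_params_def)
    have "x ^ l * f u = (\<Sum>v\<in>pverts G. real (num_walks G l u v) * f v)"
      using sum_num_walks_eigenfunction[OF f(1,2)] by simp
    also have "\<dots> = (\<Sum>v\<in>pverts G. (real lam - real mu) * (?a v * f v) + real mu * f v
        + (real nu - real mu) * (?i v * f v))"
      by (intro sum.cong refl) (simp only: walks ring_distribs mult.assoc)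
    also have "\<dots> = (real lam - real mu) * (\<Sum>v\<in>pverts G. ?a v * f v)
        + real mu * (\<Sum>v\<in>pverts G. f v) + (real nu - real mu) * (\<Sum>v\<in>pverts G. ?i v * f v)"
      by (simp only: sum.distrib sum_distrib_left)
    also have "(\<Sum>v\<in>pverts G. ?a v * f v) = x * f u"
      using f by (simp add: eigenfunction_def)
    also have "(\<Sum>v\<in>pverts G. f v) = 0"
      by (rule sum_eigenfunction_eq_0[OF f(1) assms(1) x(2)])
    also have "(\<Sum>v\<in>pverts G. ?i v * f v) = f u"
      using f(2) by (simp add: if_distrib[of "\<lambda>c. c * _"] cong: if_cong)
    finally have "x ^ l * f u = ((real lam - real mu) * x + (real nu - real mu)) * f u"
      by (simp add: algebra_simps)
    then show ?thesis using f(3) by simp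
  qed
  then show ?thesis using that by blast
qed

theorem theorem4p4:
  fixes G :: "'a pair_pre_digraph" and k :: nat and th1 th2 th3 :: real
  assumes "pair_graph G"
    and "Digraph_Component.connected (with_proj G)"
    and "regular_of_valency G k"
    and "graph_eigenvalues G = {real k, th1, th2, th3}"
    and "real k > th1" and "th1 > th2" and "th2 > th3"
    and "th2 \<noteq> 0 \<or> th3 \<noteq> - th1"
  shows "\<exists>\<^sub>\<le>\<^sub>1 l::nat. l > 1 \<and> strongly_walk_regular G l"
proof -
  interpret pair_graph G by fact
  \<comment> \<open>Two different lengths can be ordered, so refuting \<open>l < m\<close> suffices.
    The three eigenvalues below enter in increasing order, from \<open>th3\<close> to
    \<open>th1\<close>.\<close>
  have distinct: False
    if l: "1 < l" "strongly_walk_regular G l" and m: "l < m" "strongly_walk_regular G m" for l m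
  proof -
    obtain a b :: real where
      p: "\<And>x. \<lbrakk>x \<in> graph_eigenvalues G; x \<noteq> real k\<rbrakk> \<Longrightarrow> x ^ l = a * x + b"
      using strongly_walk_regular_trinomial[OF assms(3) l(2)] by blast
    obtain c d :: real where
      q: "\<And>x. \<lbrakk>x \<in> graph_eigenvalues G; x \<noteq> real k\<rbrakk> \<Longrightarrow> x ^ m = c * x + d"
      using strongly_walk_regular_trinomial[OF assms(3) m(2)] by blast
    have ev: "t \<in> graph_eigenvalues G \<and> t \<noteq> real k" if "t \<in> {th3, th2, th1}" for t
      using that assms(4-7) by auto
    show False
      by (rule no_common_roots_less[OF assms(7,6) l(1) m(1) assms(8)]) (use ev p q in blast)+
  qed
  show ?thesis
    by (rule Uniq_I) (metis distinct linorder_neqE_nat)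
qed

end
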